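(* Let $\tau\in\{*,\dagger\}$ (with $n$ even if $\tau=\dagger$), let $\iota\in\mathbb Z$, and let $\mathcal M$ be a weighted $\mathcal L^{\tau,\vec\ell}_\iota$-module generated by a subspace $\mathcal M_0$ such that $\mathcal L^{\tau,\vec\ell}_{\iota,s}(\mathcal M_0)=\{0\}$ for some $s\in\mathbb N$ with $s>\bar\ell$. Then the representation $\sigma_\tau$ on $\mathcal M$ (of $\hat o(\vec\ell,\mathbb A)$ if $\tau=*$, of $\widehat{sp}(\vec\ell,\mathbb A)$ if $\tau=\dagger$) is irreducible if and only if $\mathcal M$ is irreducible as an $\mathcal L^{\tau,\vec\ell}_\iota$-module.
   Context: All spaces are over $\mathbb C$; $\mathbb N$ = nonnegative integers; $\overline{1,n}=\{1,\dots,n\}$; $\mathcal Z=\mathbb Z+1/2$; $\langle\mu\rangle_0=1$, $\langle\mu\rangle_m=\mu(\mu-1)\cdots(\mu-m+1)$. For $l\in\mathbb Z$ write $l=l_Qn+l_R$ with $l_Q\in\mathbb Z$, $l_R\in\overline{1,n}$. $\partial_t=d/dt$, $\mathbb A=\sum_{i\ge0}\mathbb C[t,t^{-1}]\partial_t^i$, $E_{i,j}$ the $n\times n$ matrix units. Put $i^*=n+1-i$; fix $\epsilon\in\{0,1\}$ and $\vec\ell\in\mathbb N^n$ with $\ell_i\in2\mathbb N+\epsilon$, $\ell_i=\ell_{i^*}$ for all $i$. If $n=2n_0$, $p(i)=0$ and $p(n_0+i)=1$ for $i\in\overline{1,n_0}$. Put $s^*_{i,j}=1$ and $s^\dagger_{i,j}=(-1)^{p(i)+p(j)}$.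 $\widehat{gl}(n,\mathbb A)=M_{n\times n}(\mathbb A)\oplus\mathbb C\kappa$ has $\kappa$ central and $$[t^{m_1}\partial_t^{r_1}E_{i_1,j_1},t^{m_2}\partial_t^{r_2}E_{i_2,j_2}]=\delta_{j_1,i_2}t^{m_1}\partial_t^{r_1}\cdot t^{m_2}\partial_t^{r_2}E_{i_1,j_2}-\delta_{i_1,j_2}t^{m_2}\partial_t^{r_2}\cdot t^{m_1}\partial_t^{r_1}E_{i_2,j_1}+(-1)^{r_1}\delta_{i_1,j_2}\delta_{j_1,i_2}\delta_{r_1+r_2,m_1+m_2}r_1!r_2!\binom{m_1}{r_1+r_2+1}\kappa.$$ $\hat o(\vec\ell,\mathbb A)$ ($\tau=*$) and $\widehat{sp}(\vec\ell,\mathbb A)$ ($\tau=\dagger$, $n$ even) are the Lie subalgebras spanned by $\kappa$ and the coefficients of $$(E_{i,j})^\tau_{\vec\ell}(r,z)=\sum_{m\in\mathbb Z}\bigl(t^m\partial_t^{r+\ell_j}E_{i,j}-(-1)^\epsilon s^\tau_{i,j}(-\partial_t)^rt^m\partial_t^{\ell_i}E_{j^*,i^*}\bigr)z^{-m-1},\qquad i,j\in\overline{1,n},\ r\in\mathbb N.$$ $\overline{gl}(\infty)$ has basis $\{\mathcal E_{l,k}\mid l,k\in\mathcal Z\}$ with $\mathcal E_{l_1,l_2}\mathcal E_{k_1,k_2}=\delta_{l_2+k_1,0}\mathcal E_{l_1,k_2}$. Define $\hat H_1,\hat H_2:\mathcal Z\to\{0,1\}$ by: $\hat H_1(l)=1$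 iff ($n\iota<l<0$) or ($l>0$ and $l>(\iota-\ell_{(l+1/2)_R})n$); $\hat H_2(l)=1$ iff ($l>0$ and $l>-\iota n$) or ($(\ell_{(-l+1/2)_R}-\iota)n<l<0$). Put $$\beta(l_1,l_2;k_1,k_2)=\bigl(\hat H_1(l_1)\hat H_2(l_2)-\hat H_1(k_1)\hat H_2(k_2)\bigr)\delta_{l_1+k_2,0}\delta_{l_2+k_1,0}.$$ $\widetilde{gl}^{(\iota)}_{\vec\ell}(\infty)=\overline{gl}(\infty)\oplus\mathbb C\kappa_0$ is the Lie algebra with $\kappa_0$ central and $[\mathcal E_{l_1,l_2},\mathcal E_{k_1,k_2}]=\mathcal E_{l_1,l_2}\mathcal E_{k_1,k_2}-\mathcal E_{k_1,k_2}\mathcal E_{l_1,l_2}+\beta(l_1,l_2;k_1,k_2)\kappa_0$. For $l\in\mathbb Z$ and $i\in\overline{1,n}$ put $c_i(l)=\langle l+\ell_i\rangle_{\ell_i}$ if $l\ge0$ and $c_i(l)=\langle l\rangle_{\ell_i}$ if $l<0$, and for $l,k\in\mathbb Z$ $$X^\tau_{i,j}(l,k)=(-1)^\epsilon c_j(k-1)\,\mathcal E_{ln+i-1/2,\,kn-j+1/2}-s^\tau_{i,j}\,c_i(l)\,\mathcal E_{kn-j+1/2,\,ln+i-1/2}.$$ $\mathcal L^{\tau,\vec\ell}_\iota$ is the Lie subalgebra of $\widetilde{gl}^{(\iota)}_{\vec\ell}(\infty)$ spanned by $\kappa_0$ and all $X^\tau_{i,j}(l,k)$. Its toral Cartan subalgebra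 is $\mathcal T=\sum_{l\ge0}\mathbb C(\mathcal E_{l+1/2,-l-1/2}-\mathcal E_{-l-1/2,l+1/2})+\mathbb C\kappa_0$; a module is weighted if it is the direct sum of its $\mathcal T$-weight spaces. $\bar\ell=(|\iota|+\max\{\ell_1,\dots,\ell_n\})n$, and for $s>\bar\ell$, $\mathcal L^{\tau,\vec\ell}_{\iota,s}$ is the span of all $X^\tau_{l_R,k_R}(l_Q,-k_Q)$ with integers $l,k\ge s$. The representation $\sigma_\tau$ on $\mathcal M$ is given by $\sigma_\tau(\kappa)=\kappa_0$ and $$\sigma_\tau((E_{i,j})^\tau_{\vec\ell}(r,z))=\sum_{l,k\in\mathbb Z}\langle f_j(k)\rangle_r\,X^\tau_{i,j}(l,k)\,z^{e_i(l)+f_j(k)-r-1}+\bigl[(r+\ell_i)!\,\Im_{0,r+\ell_i}-(-1)^\epsilon r!\,\ell_i!\,\Im_{r,\ell_i}\bigr]\delta_{i,j}\kappa_0z^{-r-\ell_i-1},$$ where $e_i(l)=-l-\ell_i$ if $l\ge0$, $e_i(l)=-l$ if $l<0$; $f_j(k)=-k-\ell_j$ if $k\ge1$, $f_j(k)=-k$ if $k\le0$; and $\sum_{r_1,r_2\ge0}\Im_{r_1,r_2}x^{r_1}y^{r_2}z^{-r_1-r_2-1}=\frac1{x-y}\bigl((\frac{z+y}{z+x})^\iota-1\bigr)$, expanded in nonnegative powers of $x,y$. *)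

theory Defs
  imports
    Complex_Main
    "HOL-Library.Poly_Mapping"
    "HOL-Computational_Algebra.Formal_Power_Series"
begin

section \<open>Lie algebras with a given basis, and their representations\<close>

text \<open>A complex vector space with basis \<open>'b\<close> is modelled as the type \<open>'b \<Rightarrow>\<^sub>0 complex\<close> of finitely
  supported functions; the basis vector \<open>b\<close> is \<open>bvec b\<close>.\<close>

definition pscale :: "complex \<Rightarrow> ('b \<Rightarrow>\<^sub>0 complex) \<Rightarrow> ('b \<Rightarrow>\<^sub>0 complex)" where
  "pscale c x = Poly_Mapping.map ((*) c) x"

abbreviation bvec :: "'b \<Rightarrow> ('b \<Rightarrow>\<^sub>0 complex)" where
  "bvec b \<equiv> Poly_Mapping.single b 1"

lemma lookup_pscale: "Poly_Mapping.lookup (pscale c x) b = c * Poly_Mapping.lookup x b"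
  by (simp add: pscale_def Poly_Mapping.map.rep_eq when_def)

lemma vector_space_pscale: "vector_space (pscale :: complex \<Rightarrow> ('b \<Rightarrow>\<^sub>0 complex) \<Rightarrow> _)"
  by unfold_locales (auto intro!: poly_mapping_eqI simp: lookup_pscale lookup_add algebra_simps)

definition bilinear_ext ::
    "('b \<Rightarrow> 'b \<Rightarrow> ('b \<Rightarrow>\<^sub>0 complex)) \<Rightarrow> ('b \<Rightarrow>\<^sub>0 complex) \<Rightarrow> ('b \<Rightarrow>\<^sub>0 complex) \<Rightarrow> ('b \<Rightarrow>\<^sub>0 complex)" where
  "bilinear_ext br x y = (\<Sum>p\<in>Poly_Mapping.keys x. \<Sum>q\<in>Poly_Mapping.keys y.
     pscale (Poly_Mapping.lookup x p * Poly_Mapping.lookup y q) (br p q))"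

text \<open>\<open>lie_rep br L scale \<rho>\<close>: the (total) function \<open>\<rho>\<close> restricts to a representation of the Lie
  algebra \<open>L\<close>, with bracket \<open>br\<close>, on the vector space given by the type \<open>'v\<close> with scalar
  multiplication \<open>scale\<close>.\<close>

definition lie_rep ::
    "(('b \<Rightarrow>\<^sub>0 complex) \<Rightarrow> ('b \<Rightarrow>\<^sub>0 complex) \<Rightarrow> ('b \<Rightarrow>\<^sub>0 complex)) \<Rightarrow> ('b \<Rightarrow>\<^sub>0 complex) set \<Rightarrow>
     (complex \<Rightarrow> 'v :: ab_group_add \<Rightarrow> 'v) \<Rightarrow> (('b \<Rightarrow>\<^sub>0 complex) \<Rightarrow> 'v \<Rightarrow> 'v) \<Rightarrow> bool" where
  "lie_rep br L scale \<rho> \<longleftrightarrow>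
     vector_space scale \<and>
     (\<forall>x\<in>L. Vector_Spaces.linear scale scale (\<rho> x)) \<and>
     (\<forall>x\<in>L. \<forall>y\<in>L. \<forall>v. \<rho> (x + y) v = \<rho> x v + \<rho> y v) \<and>
     (\<forall>c. \<forall>x\<in>L. \<forall>v. \<rho> (pscale c x) v = scale c (\<rho> x v)) \<and>
     (\<forall>x\<in>L. \<forall>y\<in>L. \<forall>v. \<rho> (br x y) v = \<rho> x (\<rho> y v) - \<rho> y (\<rho> x v))"

definition submodule ::
    "('b \<Rightarrow>\<^sub>0 complex) set \<Rightarrow> (complex \<Rightarrow> 'v :: ab_group_add \<Rightarrow> 'v) \<Rightarrow>
     (('b \<Rightarrow>\<^sub>0 complex) \<Rightarrow> 'v \<Rightarrow> 'v) \<Rightarrow> 'v set \<Rightarrow> bool" where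
  "submodule L scale \<rho> U \<longleftrightarrow> module.subspace scale U \<and> (\<forall>x\<in>L. \<forall>u\<in>U. \<rho> x u \<in> U)"

definition irreducible_rep ::
    "('b \<Rightarrow>\<^sub>0 complex) set \<Rightarrow> (complex \<Rightarrow> 'v :: ab_group_add \<Rightarrow> 'v) \<Rightarrow>
     (('b \<Rightarrow>\<^sub>0 complex) \<Rightarrow> 'v \<Rightarrow> 'v) \<Rightarrow> bool" where
  "irreducible_rep L scale \<rho> \<longleftrightarrow>
     (UNIV :: 'v set) \<noteq> {0} \<and> (\<forall>U. submodule L scale \<rho> U \<longrightarrow> U = {0} \<or> U = UNIV)"

definition generated_by ::
    "('b \<Rightarrow>\<^sub>0 complex) set \<Rightarrow> (complex \<Rightarrow> 'v :: ab_group_add \<Rightarrow> 'v) \<Rightarrow>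
     (('b \<Rightarrow>\<^sub>0 complex) \<Rightarrow> 'v \<Rightarrow> 'v) \<Rightarrow> 'v set \<Rightarrow> bool" where
  "generated_by L scale \<rho> M0 \<longleftrightarrow> (\<forall>U. submodule L scale \<rho> U \<and> M0 \<subseteq> U \<longrightarrow> U = UNIV)"

text \<open>A weight is a linear functional on \<open>T\<close>, extended by \<open>0\<close> outside \<open>T\<close> so that each functional
  on \<open>T\<close> is represented exactly once.\<close>

definition weights :: "('b \<Rightarrow>\<^sub>0 complex) set \<Rightarrow> (('b \<Rightarrow>\<^sub>0 complex) \<Rightarrow> complex) set" where
  "weights T = {\<phi>. (\<forall>x\<in>T. \<forall>y\<in>T. \<phi> (x + y) = \<phi> x + \<phi> y) \<and>
     (\<forall>c. \<forall>x\<in>T. \<phi> (pscale c x) = c * \<phi> x) \<and> (\<forall>x. x \<notin> T \<longrightarrow> \<phi> x = 0)}"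

definition weight_space ::
    "('b \<Rightarrow>\<^sub>0 complex) set \<Rightarrow> (complex \<Rightarrow> 'v :: ab_group_add \<Rightarrow> 'v) \<Rightarrow>
     (('b \<Rightarrow>\<^sub>0 complex) \<Rightarrow> 'v \<Rightarrow> 'v) \<Rightarrow> (('b \<Rightarrow>\<^sub>0 complex) \<Rightarrow> complex) \<Rightarrow> 'v set" where
  "weight_space T scale \<rho> \<phi> = {v. \<forall>h\<in>T. \<rho> h v = scale (\<phi> h) v}"

definition weighted ::
    "('b \<Rightarrow>\<^sub>0 complex) set \<Rightarrow> (complex \<Rightarrow> 'v :: ab_group_add \<Rightarrow> 'v) \<Rightarrow>
     (('b \<Rightarrow>\<^sub>0 complex) \<Rightarrow> 'v \<Rightarrow> 'v) \<Rightarrow> bool" where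
  "weighted T scale \<rho> \<longleftrightarrow>
     (\<forall>v. \<exists>!f. (\<forall>\<phi>\<in>weights T. f \<phi> \<in> weight_space T scale \<rho> \<phi>) \<and> (\<forall>\<phi>. \<phi> \<notin> weights T \<longrightarrow> f \<phi> = 0) \<and>
        finite {\<phi>. f \<phi> \<noteq> 0} \<and> v = (\<Sum>\<phi> | f \<phi> \<noteq> 0. f \<phi>))"


section \<open>Indices and signs\<close>

definition falling :: "complex \<Rightarrow> nat \<Rightarrow> complex" where
  "falling \<mu> m = (\<Prod>k<m. \<mu> - of_nat k)"

text \<open>The decomposition \<open>l = quo n l * n + rem n l\<close> with \<open>1 \<le> rem n l \<le> n\<close>.\<close>

definition quo :: "nat \<Rightarrow> int \<Rightarrow> int" where
  "quo n l = (l - 1) div int n"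

definition rem :: "nat \<Rightarrow> int \<Rightarrow> nat" where
  "rem n l = nat ((l - 1) mod int n) + 1"

definition star :: "nat \<Rightarrow> nat \<Rightarrow> nat" where
  "star n i = n + 1 - i"

datatype tau = Star | Dagger

definition parity :: "nat \<Rightarrow> nat \<Rightarrow> nat" where
  "parity n i = (if i \<le> n div 2 then 0 else 1)"

definition sgn_tau :: "nat \<Rightarrow> tau \<Rightarrow> nat \<Rightarrow> nat \<Rightarrow> complex" where
  "sgn_tau n \<tau> i j = (case \<tau> of Star \<Rightarrow> 1 | Dagger \<Rightarrow> (- 1) ^ (parity n i + parity n j))"


section \<open>The central extension of matrix differential operators\<close>

text \<open>\<open>DO m r i j\<close> stands for the basis element \<open>t\<^sup>m \<partial>\<^sub>t\<^sup>r E\<^sub>i\<^sub>,\<^sub>j\<close>.\<close>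

datatype dbasis = DO int nat nat nat | Kap

text \<open>\<open>dprod m1 r1 m2 r2 i j\<close> is \<open>(t\<^bsup>m1\<^esup> \<partial>\<^sub>t\<^bsup>r1\<^esup> \<cdot> t\<^bsup>m2\<^esup> \<partial>\<^sub>t\<^bsup>r2\<^esup>) E\<^sub>i\<^sub>,\<^sub>j\<close>, brought into normal order by the Leibniz
  rule \<open>\<partial>\<^sub>t\<^sup>r \<cdot> t\<^sup>m = (\<Sum>p\<le>r. (r choose p) \<langle>m\<rangle>\<^sub>p t\<^bsup>m-p\<^esup> \<partial>\<^sub>t\<^bsup>r-p\<^esup>)\<close>.\<close>

definition dprod :: "int \<Rightarrow> nat \<Rightarrow> int \<Rightarrow> nat \<Rightarrow> nat \<Rightarrow> nat \<Rightarrow> (dbasis \<Rightarrow>\<^sub>0 complex)" where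
  "dprod m1 r1 m2 r2 i j = (\<Sum>p\<le>r1. pscale (of_nat (r1 choose p) * falling (of_int m2) p)
     (bvec (DO (m1 + m2 - int p) (r1 + r2 - p) i j)))"

fun dbracket_basis :: "dbasis \<Rightarrow> dbasis \<Rightarrow> (dbasis \<Rightarrow>\<^sub>0 complex)" where
  "dbracket_basis (DO m1 r1 i1 j1) (DO m2 r2 i2 j2) =
     (if j1 = i2 then dprod m1 r1 m2 r2 i1 j2 else 0)
     - (if i1 = j2 then dprod m2 r2 m1 r1 i2 j1 else 0)
     + (if i1 = j2 \<and> j1 = i2 \<and> int (r1 + r2) = m1 + m2
        then pscale ((- 1) ^ r1 * fact r1 * fact r2 * (of_int m1 gchoose (r1 + r2 + 1))) (bvec Kap)
        else 0)"
| "dbracket_basis _ _ = 0"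

definition dbracket :: "(dbasis \<Rightarrow>\<^sub>0 complex) \<Rightarrow> (dbasis \<Rightarrow>\<^sub>0 complex) \<Rightarrow> (dbasis \<Rightarrow>\<^sub>0 complex)" where
  "dbracket = bilinear_ext dbracket_basis"

text \<open>The coefficient of \<open>z\<^bsup>-m-1\<^esup>\<close> in \<open>(E\<^sub>i\<^sub>,\<^sub>j)\<^sup>\<tau>(r,z)\<close>.\<close>

definition dgen :: "nat \<Rightarrow> nat \<Rightarrow> (nat \<Rightarrow> nat) \<Rightarrow> tau \<Rightarrow> nat \<Rightarrow> nat \<Rightarrow> nat \<Rightarrow> int \<Rightarrow> (dbasis \<Rightarrow>\<^sub>0 complex)" where
  "dgen n \<epsilon> ell \<tau> i j r m =
     bvec (DO m (r + ell j) i j)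
     - pscale ((- 1) ^ \<epsilon> * sgn_tau n \<tau> i j)
         (pscale ((- 1) ^ r) (dprod 0 r m (ell i) (star n j) (star n i)))"

text \<open>The orthogonal (\<open>Star\<close>) and symplectic (\<open>Dagger\<close>) subalgebras.\<close>

definition osp_alg :: "nat \<Rightarrow> nat \<Rightarrow> (nat \<Rightarrow> nat) \<Rightarrow> tau \<Rightarrow> (dbasis \<Rightarrow>\<^sub>0 complex) set" where
  "osp_alg n \<epsilon> ell \<tau> = module.span pscale
     ({bvec Kap} \<union> {dgen n \<epsilon> ell \<tau> i j r m | i j r m. i \<in> {1..n} \<and> j \<in> {1..n}})"


section \<open>The central extension of infinite matrices\<close>

text \<open>The half-integer \<open>a + 1/2\<close> is encoded by the integer \<open>a\<close>, so \<open>EE a b\<close> stands for the basis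
  element of index \<open>(a + 1/2, b + 1/2)\<close>. Thus \<open>- (a + 1/2)\<close> is encoded by \<open>- a - 1\<close>, two half-integers
  sum to \<open>0\<close> iff their codes sum to \<open>- 1\<close>, and \<open>l * n + i - 1/2\<close> and \<open>k * n - j + 1/2\<close> have the codes
  \<open>l * n + i - 1\<close> and \<open>k * n - j\<close>.\<close>

datatype ebasis = EE int int | Kap0

definition half :: "int \<Rightarrow> real" where
  "half a = of_int a + 1/2"

definition H1 :: "nat \<Rightarrow> (nat \<Rightarrow> nat) \<Rightarrow> int \<Rightarrow> int \<Rightarrow> complex" where
  "H1 n ell \<iota> a =
     (if (of_int (int n * \<iota>) < half a \<and> half a < 0) \<or>
         (half a > 0 \<and> half a > of_int ((\<iota> - int (ell (rem n (a + 1)))) * int n))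
      then 1 else 0)"

definition H2 :: "nat \<Rightarrow> (nat \<Rightarrow> nat) \<Rightarrow> int \<Rightarrow> int \<Rightarrow> complex" where
  "H2 n ell \<iota> a =
     (if (half a > 0 \<and> half a > of_int (- \<iota> * int n)) \<or>
         (of_int ((int (ell (rem n (- a))) - \<iota>) * int n) < half a \<and> half a < 0)
      then 1 else 0)"

definition beta :: "nat \<Rightarrow> (nat \<Rightarrow> nat) \<Rightarrow> int \<Rightarrow> int \<Rightarrow> int \<Rightarrow> int \<Rightarrow> int \<Rightarrow> complex" where
  "beta n ell \<iota> a1 a2 b1 b2 =
     (if a1 + b2 = - 1 \<and> a2 + b1 = - 1
      then H1 n ell \<iota> a1 * H2 n ell \<iota> a2 - H1 n ell \<iota> b1 * H2 n ell \<iota> b2 else 0)"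

fun ebracket_basis :: "nat \<Rightarrow> (nat \<Rightarrow> nat) \<Rightarrow> int \<Rightarrow> ebasis \<Rightarrow> ebasis \<Rightarrow> (ebasis \<Rightarrow>\<^sub>0 complex)" where
  "ebracket_basis n ell \<iota> (EE a1 a2) (EE b1 b2) =
     (if a2 + b1 = - 1 then bvec (EE a1 b2) else 0)
     - (if b2 + a1 = - 1 then bvec (EE b1 a2) else 0)
     + pscale (beta n ell \<iota> a1 a2 b1 b2) (bvec Kap0)"
| "ebracket_basis n ell \<iota> _ _ = 0"

definition ebracket ::
    "nat \<Rightarrow> (nat \<Rightarrow> nat) \<Rightarrow> int \<Rightarrow> (ebasis \<Rightarrow>\<^sub>0 complex) \<Rightarrow> (ebasis \<Rightarrow>\<^sub>0 complex) \<Rightarrow> (ebasis \<Rightarrow>\<^sub>0 complex)" where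
  "ebracket n ell \<iota> = bilinear_ext (ebracket_basis n ell \<iota>)"

definition cc :: "(nat \<Rightarrow> nat) \<Rightarrow> nat \<Rightarrow> int \<Rightarrow> complex" where
  "cc ell i l = (if l \<ge> 0 then falling (of_int (l + int (ell i))) (ell i) else falling (of_int l) (ell i))"

definition XX :: "nat \<Rightarrow> nat \<Rightarrow> (nat \<Rightarrow> nat) \<Rightarrow> tau \<Rightarrow> nat \<Rightarrow> nat \<Rightarrow> int \<Rightarrow> int \<Rightarrow> (ebasis \<Rightarrow>\<^sub>0 complex)" where
  "XX n \<epsilon> ell \<tau> i j l k =
     pscale ((- 1) ^ \<epsilon> * cc ell j (k - 1)) (bvec (EE (l * int n + int i - 1) (k * int n - int j)))
     - pscale (sgn_tau n \<tau> i j * cc ell i l) (bvec (EE (k * int n - int j) (l * int n + int i - 1)))"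

definition L_alg :: "nat \<Rightarrow> nat \<Rightarrow> (nat \<Rightarrow> nat) \<Rightarrow> tau \<Rightarrow> (ebasis \<Rightarrow>\<^sub>0 complex) set" where
  "L_alg n \<epsilon> ell \<tau> = module.span pscale
     ({bvec Kap0} \<union> {XX n \<epsilon> ell \<tau> i j l k | i j l k. i \<in> {1..n} \<and> j \<in> {1..n}})"

definition torus :: "(ebasis \<Rightarrow>\<^sub>0 complex) set" where
  "torus = module.span pscale
     ({bvec Kap0} \<union> {bvec (EE l (- l - 1)) - bvec (EE (- l - 1) l) | l. l \<ge> 0})"

definition ell_bar :: "nat \<Rightarrow> (nat \<Rightarrow> nat) \<Rightarrow> int \<Rightarrow> int" where
  "ell_bar n ell \<iota> = (\<bar>\<iota>\<bar> + int (Max (ell ` {1..n}))) * int n"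

definition L_trunc :: "nat \<Rightarrow> nat \<Rightarrow> (nat \<Rightarrow> nat) \<Rightarrow> tau \<Rightarrow> nat \<Rightarrow> (ebasis \<Rightarrow>\<^sub>0 complex) set" where
  "L_trunc n \<epsilon> ell \<tau> s = module.span pscale
     {XX n \<epsilon> ell \<tau> (rem n l) (rem n k) (quo n l) (- quo n k) | l k. l \<ge> int s \<and> k \<ge> int s}"


section \<open>The representation sigma\<close>

definition e_exp :: "(nat \<Rightarrow> nat) \<Rightarrow> nat \<Rightarrow> int \<Rightarrow> int" where
  "e_exp ell i l = (if l \<ge> 0 then - l - int (ell i) else - l)"

definition f_exp :: "(nat \<Rightarrow> nat) \<Rightarrow> nat \<Rightarrow> int \<Rightarrow> int" where
  "f_exp ell j k = (if k \<ge> 1 then - k - int (ell j) else - k)"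

text \<open>The generating function of the constants \<open>Im\<^bsub>r1,r2\<^esub>\<close>, as a power series in \<open>x\<close> whose coefficients
  are power series in \<open>y\<close>. It is homogeneous of degree \<open>-1\<close> in \<open>x, y, z\<close>, so that we may put \<open>z = 1\<close>.
  Thus \<open>x\<close> is \<open>fps_X\<close>, \<open>y\<close> is \<open>fps_const fps_X\<close>, and \<open>ratio_pow \<iota>\<close> is the expansion of
  \<open>((1 + y) / (1 + x))\<^sup>\<iota>\<close>.\<close>

definition ratio_pow :: "int \<Rightarrow> complex fps fps" where
  "ratio_pow \<iota> = Abs_fps (\<lambda>p. fps_const (of_int (- \<iota>) gchoose p)) * fps_const (fps_binomial (of_int \<iota>))"

definition Im_gf :: "int \<Rightarrow> complex fps fps" where
  "Im_gf \<iota> = (THE F. (fps_X - fps_const fps_X) * F = ratio_pow \<iota> - 1)"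

definition Im_coeff :: "int \<Rightarrow> nat \<Rightarrow> nat \<Rightarrow> complex" where
  "Im_coeff \<iota> r1 r2 = fps_nth (fps_nth (Im_gf \<iota>) r1) r2"

lemma Im_gf_ex1: "\<exists>!F. (fps_X - fps_const fps_X) * F = ratio_pow \<iota> - 1"
proof (rule ex_ex1I)
  define a where "a p q = (of_int (- \<iota>) gchoose p) * (of_int \<iota> gchoose q) -
      (if p = 0 \<and> q = 0 then 1 else 0 :: complex)" for p q :: nat
  have a: "fps_nth (fps_nth (ratio_pow \<iota> - 1) p) q = a p q" for p q
    by (simp add: ratio_pow_def a_def fps_binomial_def fps_eq_iff)
  have zero: "(\<Sum>t\<le>m. a t (m - t)) = 0" for m
  proof -
    have "(\<Sum>t\<le>m. a t (m - t)) =
        (\<Sum>t\<le>m. (of_int (- \<iota>) gchoose t) * (of_int \<iota> gchoose (m - t))) -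
        (\<Sum>t\<le>m. if t = 0 \<and> m - t = 0 then 1 else 0 :: complex)"
      by (simp add: a_def sum_subtractf)
    also have "(\<Sum>t\<le>m. (of_int (- \<iota>) gchoose t) * (of_int \<iota> gchoose (m - t)))
        = ((of_int (- \<iota>) + of_int \<iota> :: complex) gchoose m)"
      using gbinomial_Vandermonde[of "of_int (- \<iota>) :: complex" "of_int \<iota>" m]
      by (simp add: atLeast0AtMost)
    also have "(\<Sum>t\<le>m. if t = 0 \<and> m - t = 0 then 1 else 0 :: complex) = (if m = 0 then 1 else 0)"
      by (cases m) (auto intro!: sum.neutral)
    finally show ?thesis
      by (cases m) simp_all
  qed
  define F :: "complex fps fps" where
    "F = Abs_fps (\<lambda>p. Abs_fps (\<lambda>q. - (\<Sum>t\<le>p. a t (p + q + 1 - t))))"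
  have "fps_nth (fps_nth ((fps_X - fps_const fps_X) * F) p) q = a p q" for p q
  proof (cases p; cases q)
    assume "p = 0" "q = 0"
    then show ?thesis by (simp add: a_def algebra_simps)
  next
    fix q' assume "p = 0" "q = Suc q'"
    then show ?thesis by (simp add: F_def algebra_simps)
  next
    fix p' assume "p = Suc p'" "q = 0"
    then show ?thesis using zero[of p] by (simp add: F_def algebra_simps neg_eq_iff_add_eq_0)
  next
    fix p' q' assume "p = Suc p'" "q = Suc q'"
    then show ?thesis by (simp add: F_def algebra_simps)
  qed
  then have "(fps_X - fps_const fps_X) * F = ratio_pow \<iota> - 1"
    by (intro fps_ext) (simp only: a)
  then show "\<exists>F. (fps_X - fps_const fps_X) * F = ratio_pow \<iota> - 1" ..
next
  fix F G assume *: "(fps_X - fps_const fps_X) * F = ratio_pow \<iota> - 1"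
    "(fps_X - fps_const fps_X) * G = ratio_pow \<iota> - 1"
  have "fps_nth (fps_X - fps_const fps_X :: complex fps fps) 1 \<noteq> fps_nth 0 1"
    by simp
  then have "fps_X - fps_const fps_X \<noteq> (0 :: complex fps fps)"
    by metis
  then show "F = G" using * by (metis mult_cancel_left)
qed

text \<open>The operator on the module which is the coefficient of \<open>z\<^bsup>-m-1\<^esup>\<close> in the image of
  \<open>(E\<^sub>i\<^sub>,\<^sub>j)\<^sup>\<tau>(r,z)\<close>. The sum over all \<open>(l, k)\<close> in question is infinite; it is evaluated pointwise,
  the terms that do not vanish at the given vector being finitely many for the modules considered.\<close>

definition sigma_op ::
    "nat \<Rightarrow> nat \<Rightarrow> (nat \<Rightarrow> nat) \<Rightarrow> tau \<Rightarrow> int \<Rightarrow> (complex \<Rightarrow> 'v :: ab_group_add \<Rightarrow> 'v) \<Rightarrow>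
     ((ebasis \<Rightarrow>\<^sub>0 complex) \<Rightarrow> 'v \<Rightarrow> 'v) \<Rightarrow> nat \<Rightarrow> nat \<Rightarrow> nat \<Rightarrow> int \<Rightarrow> 'v \<Rightarrow> 'v" where
  "sigma_op n \<epsilon> ell \<tau> \<iota> scale \<rho> i j r m v =
     (let summand = (\<lambda>(l, k). scale (falling (of_int (f_exp ell j k)) r) (\<rho> (XX n \<epsilon> ell \<tau> i j l k) v))
      in \<Sum>(l, k) | e_exp ell i l + f_exp ell j k - int r - 1 = - m - 1 \<and> summand (l, k) \<noteq> 0. summand (l, k))
     + (if i = j \<and> - int r - int (ell i) - 1 = - m - 1
        then scale (fact (r + ell i) * Im_coeff \<iota> 0 (r + ell i)
                    - (- 1) ^ \<epsilon> * fact r * fact (ell i) * Im_coeff \<iota> r (ell i))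
               (\<rho> (bvec Kap0) v)
        else 0)"

text \<open>The prescribed values determine \<open>\<sigma>\<close> on \<open>osp_alg\<close>, since their arguments span it.\<close>

definition is_sigma ::
    "nat \<Rightarrow> nat \<Rightarrow> (nat \<Rightarrow> nat) \<Rightarrow> tau \<Rightarrow> int \<Rightarrow> (complex \<Rightarrow> 'v :: ab_group_add \<Rightarrow> 'v) \<Rightarrow>
     ((ebasis \<Rightarrow>\<^sub>0 complex) \<Rightarrow> 'v \<Rightarrow> 'v) \<Rightarrow> ((dbasis \<Rightarrow>\<^sub>0 complex) \<Rightarrow> 'v \<Rightarrow> 'v) \<Rightarrow> bool" where
  "is_sigma n \<epsilon> ell \<tau> \<iota> scale \<rho> \<sigma> \<longleftrightarrow>
     lie_rep dbracket (osp_alg n \<epsilon> ell \<tau>) scale \<sigma> \<and>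
     (\<forall>v. \<sigma> (bvec Kap) v = \<rho> (bvec Kap0) v) \<and>
     (\<forall>i\<in>{1..n}. \<forall>j\<in>{1..n}. \<forall>r m v.
        \<sigma> (dgen n \<epsilon> ell \<tau> i j r m) v = sigma_op n \<epsilon> ell \<tau> \<iota> scale \<rho> i j r m v)"

end

theory Submission
  imports Defs
begin

text \<open>
  A subspace \<open>U\<close> of the module is invariant under \<open>\<sigma>\<close> if and only if it is invariant under \<open>\<rho>\<close>;
  irreducibility of either representation is then irreducibility of the other.

  One direction is immediate: on each vector, \<open>\<sigma>\<close> acts by finite linear combinations of operators
  \<open>\<rho> x\<close>.

  Conversely let \<open>U\<close> be invariant under \<open>\<sigma>\<close>, and let \<open>v \<in> U\<close>. Fix \<open>i\<close>, \<open>j\<close> and the total exponent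
  \<open>d = e\<^sub>i(l) + f\<^sub>j(k)\<close>. Up to a multiple of \<open>\<kappa>\<^sub>0\<close>, which acts as \<open>\<sigma>(\<kappa>)\<close>, the operators of \<open>\<sigma>\<close> with this \<open>d\<close>
  are the sums of the \<open>\<langle>f\<^sub>j(k)\<rangle>\<^sub>r X\<^sub>i\<^sub>,\<^sub>j(l,k)\<close> for \<open>r = 0, 1, 2, \<dots>\<close>. If only finitely many \<open>X\<^sub>i\<^sub>,\<^sub>j(l,k) v\<close>
  with this \<open>d\<close> are nonzero, then, since the falling factorials span all polynomials and the numbers
  \<open>f\<^sub>j(k)\<close> are distinct, Lagrange interpolation isolates each \<open>X\<^sub>i\<^sub>,\<^sub>j(l,k) v\<close> and puts it into \<open>U\<close>
  (lemma \<open>summand_in_subspace\<close>).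

  The finiteness holds because the vectors that satisfy it form a submodule: commuting \<open>X\<^sub>i\<^sub>,\<^sub>j(l,k)\<close>
  past a fixed element of the algebra costs a commutator that vanishes for all but finitely many
  \<open>(l, k)\<close> with the given \<open>d\<close>. This submodule contains the generating space: along \<open>d\<close> fixed, \<open>l\<close> and
  \<open>k\<close> tend to opposite infinities. For \<open>l \<rightarrow> \<infinity>\<close> the element \<open>X\<^sub>i\<^sub>,\<^sub>j(l,k)\<close> enters the truncated
  algebra, and for \<open>l \<rightarrow> -\<infinity>\<close> it does so by the symmetry
  \<open>X\<^sub>i\<^sub>,\<^sub>j(l,k) = \<plusminus> X\<^sub>j\<^sub>*\<^sub>,\<^sub>i\<^sub>*(k-1,l+1)\<close> (lemma \<open>XX_star\<close>).
\<close>

section \<open>Submodules of Lie algebra representations\<close>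

lemma pscale_0_right [simp]: "pscale c 0 = 0"
  by (simp add: poly_mapping_eqI lookup_pscale)

lemma pscale_0_left [simp]: "pscale 0 x = 0"
  by (simp add: poly_mapping_eqI lookup_pscale)

lemma bilinear_ext_eq_0:
  assumes "\<And>p q. p \<in> Poly_Mapping.keys x \<Longrightarrow> q \<in> Poly_Mapping.keys y \<Longrightarrow> br p q = 0"
  shows "bilinear_ext br x y = 0"
  unfolding bilinear_ext_def using assms by (intro sum.neutral ballI) simp

lemma lie_rep_vector_space: "lie_rep br L scale \<rho> \<Longrightarrow> vector_space scale"
  by (simp add: lie_rep_def)

lemma lie_rep_add_right:
  "lie_rep br L scale \<rho> \<Longrightarrow> x \<in> L \<Longrightarrow> \<rho> x (u + v) = \<rho> x u + \<rho> x v"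
  unfolding lie_rep_def Vector_Spaces.linear_def module_hom_def module_hom_axioms_def by blast

lemma lie_rep_scale_right:
  "lie_rep br L scale \<rho> \<Longrightarrow> x \<in> L \<Longrightarrow> \<rho> x (scale c v) = scale c (\<rho> x v)"
  unfolding lie_rep_def Vector_Spaces.linear_def module_hom_def module_hom_axioms_def by blast

lemma lie_rep_0_right: "lie_rep br L scale \<rho> \<Longrightarrow> x \<in> L \<Longrightarrow> \<rho> x 0 = 0"
  using lie_rep_add_right[of br L scale \<rho> x 0 0] by simp

lemma lie_rep_add_left:
  "lie_rep br L scale \<rho> \<Longrightarrow> x \<in> L \<Longrightarrow> y \<in> L \<Longrightarrow> \<rho> (x + y) v = \<rho> x v + \<rho> y v"
  by (simp add: lie_rep_def)

lemma lie_rep_scale_left: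
  "lie_rep br L scale \<rho> \<Longrightarrow> x \<in> L \<Longrightarrow> \<rho> (pscale c x) v = scale c (\<rho> x v)"
  by (simp add: lie_rep_def)

lemma lie_rep_0_left:
  assumes "lie_rep br L scale \<rho>" "x \<in> L"
  shows "\<rho> 0 v = 0"
proof -
  interpret vector_space scale by (rule lie_rep_vector_space[OF assms(1)])
  show ?thesis using lie_rep_scale_left[OF assms, of 0 v] by simp
qed

lemma lie_rep_commuting:
  assumes "lie_rep br L scale \<rho>" "x \<in> L" "y \<in> L" "br x y = 0"
  shows "\<rho> x (\<rho> y v) = \<rho> y (\<rho> x v)"
proof -
  have "\<rho> (br x y) v = \<rho> x (\<rho> y v) - \<rho> y (\<rho> x v)"
    using assms(1-3) by (simp add: lie_rep_def)
  then show ?thesis using lie_rep_0_left[OF assms(1,2)] assms(4) by simp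
qed

lemma submodule_spanI:
  fixes G :: "('b \<Rightarrow>\<^sub>0 complex) set"
  assumes rep: "lie_rep br (module.span pscale G) scale \<rho>"
    and U: "module.subspace scale U"
    and G: "\<And>x u. x \<in> G \<Longrightarrow> u \<in> U \<Longrightarrow> \<rho> x u \<in> U"
  shows "submodule (module.span pscale G) scale \<rho> U"
proof -
  interpret P: vector_space "pscale :: complex \<Rightarrow> ('b \<Rightarrow>\<^sub>0 complex) \<Rightarrow> _"
    by (rule vector_space_pscale)
  interpret V: vector_space scale by (rule lie_rep_vector_space[OF rep])
  have "x \<in> P.span G \<and> (\<forall>u\<in>U. \<rho> x u \<in> U)" if "x \<in> P.span G" for x
    using that
  proof (induction rule: P.span_induct_alt)
    case base
    have "0 \<in> P.span G" by (rule P.span_zero)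
    then show ?case using lie_rep_0_left[OF rep] V.subspace_0[OF U] by auto
  next
    case (step c x y)
    have x: "x \<in> P.span G" using step(1) by (rule P.span_base)
    then have "pscale c x \<in> P.span G" by (rule P.span_scale)
    then show ?case
      using x step G V.subspace_add[OF U] V.subspace_scale[OF U]
      by (auto simp: lie_rep_add_left[OF rep] lie_rep_scale_left[OF rep] intro: P.span_add)
  qed
  then show ?thesis using U by (simp add: submodule_def)
qed

section \<open>Interpolation with falling factorials\<close>

text \<open>The identity \<open>x \<langle>x\<rangle>\<^sub>r = \<langle>x\<rangle>\<^sub>r\<^sub>+\<^sub>1 + r \<langle>x\<rangle>\<^sub>r\<close> allows multiplying the coefficients by one linear factor
  \<open>x - a\<close> after the other without leaving the subspace.\<close>

lemma sum_prod_falling_in_subspace: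
  assumes "vector_space scale" and U: "module.subspace scale U"
    and sums: "\<And>r. (\<Sum>s\<in>S. scale (falling (g s) r) (w s)) \<in> U"
    and "finite T"
  shows "(\<Sum>s\<in>S. scale ((\<Prod>t\<in>T. g s - g t) * falling (g s) r) (w s)) \<in> U"
  using \<open>finite T\<close>
proof (induction T arbitrary: r)
  case empty
  then show ?case using sums by simp
next
  case (insert t T)
  interpret V: vector_space scale by fact
  let ?F = "\<lambda>r. \<Sum>s\<in>S. scale ((\<Prod>t\<in>T. g s - g t) * falling (g s) r) (w s)"
  have "(\<Sum>s\<in>S. scale ((\<Prod>t\<in>insert t T. g s - g t) * falling (g s) r) (w s))
      = ?F (Suc r) + scale (of_nat r - g t) (?F r)"
    unfolding V.scale_sum_right V.scale_scale sum.distrib[symmetric] V.scale_left_distrib[symmetric]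
    using insert.hyps
    by (intro sum.cong refl arg_cong2[where f = scale]) (simp add: falling_def algebra_simps)
  then show ?case
    using insert.IH V.subspace_add[OF U] V.subspace_scale[OF U] by auto
qed

lemma summand_in_subspace:
  assumes V: "vector_space scale" and U: "module.subspace scale U"
    and S: "finite S" "inj_on g S" "s \<in> S"
    and sums: "\<And>r. (\<Sum>s\<in>S. scale (falling (g s) r) (w s)) \<in> U"
  shows "w s \<in> U"
proof -
  interpret V: vector_space scale by fact
  let ?p = "\<lambda>u. \<Prod>t\<in>S - {s}. g u - g t"
  have "(\<Sum>u\<in>S. scale (?p u * falling (g u) 0) (w u)) \<in> U"
    using sum_prod_falling_in_subspace[OF V U sums, of "S - {s}" 0] S(1) by simp
  also have "(\<Sum>u\<in>S. scale (?p u * falling (g u) 0) (w u))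
      = (\<Sum>u\<in>S. if u = s then scale (?p s) (w s) else 0)"
  proof (intro sum.cong refl)
    fix u assume u: "u \<in> S"
    have "?p u = 0" if "u \<noteq> s"
      using S(1) u that by (intro prod_zero) auto
    then show "scale (?p u * falling (g u) 0) (w u) = (if u = s then scale (?p s) (w s) else 0)"
      by (auto simp: falling_def)
  qed
  also have "\<dots> = scale (?p s) (w s)" using S by simp
  finally have "scale (inverse (?p s)) (scale (?p s) (w s)) \<in> U"
    by (rule V.subspace_scale[OF U])
  moreover have "?p s \<noteq> 0"
    using S by (auto dest: inj_onD)
  ultimately show ?thesis by simp
qed

section \<open>Homogeneous families of generators\<close>

definition exponent_line :: "(nat \<Rightarrow> nat) \<Rightarrow> nat \<Rightarrow> nat \<Rightarrow> int \<Rightarrow> (int \<times> int) set" where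
  "exponent_line ell i j d = {(l, k). e_exp ell i l + f_exp ell j k = d}"

lemma f_exp_inj: "f_exp ell j k = f_exp ell j k' \<Longrightarrow> k = k'"
  by (auto simp: f_exp_def split: if_splits)

lemma e_exp_inj: "e_exp ell i l = e_exp ell i l' \<Longrightarrow> l = l'"
  by (auto simp: e_exp_def split: if_splits)

lemma inj_on_fst_exponent_line: "inj_on fst (exponent_line ell i j d)"
  by (rule inj_onI) (force simp: exponent_line_def dest: f_exp_inj)

lemma inj_on_snd_exponent_line: "inj_on snd (exponent_line ell i j d)"
  by (rule inj_onI) (force simp: exponent_line_def dest: e_exp_inj)

lemma finite_exponent_line:
  assumes "finite A" "finite B"
  shows "finite {(l, k) \<in> exponent_line ell i j d. l \<in> A \<or> k \<in> B}"
proof -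
  have "finite {p \<in> exponent_line ell i j d. fst p \<in> A}"
    by (rule inj_on_finite[OF inj_on_subset[OF inj_on_fst_exponent_line] _ assms(1)]) auto
  moreover have "finite {p \<in> exponent_line ell i j d. snd p \<in> B}"
    by (rule inj_on_finite[OF inj_on_subset[OF inj_on_snd_exponent_line] _ assms(2)]) auto
  ultimately show ?thesis
    by (rule finite_subset[OF _ finite_UnI, rotated]) auto
qed

lemma star_in: "i \<in> {1..n} \<Longrightarrow> star n i \<in> {1..n}"
  by (auto simp: star_def)

lemma sgn_tau_star:
  assumes "i \<in> {1..n}" "j \<in> {1..n}" "\<tau> = Dagger \<Longrightarrow> even n"
  shows "sgn_tau n \<tau> (star n j) (star n i) = sgn_tau n \<tau> i j"
proof (cases \<tau>)
  case Dagger
  have "parity n (star n i) = 1 - parity n i" if "i \<in> {1..n}" for i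
    using assms(3)[OF Dagger] that by (auto simp: parity_def star_def elim!: evenE)
  then show ?thesis using Dagger assms(1,2) by (auto simp: sgn_tau_def parity_def)
qed (simp add: sgn_tau_def)

lemma sgn_tau_square: "sgn_tau n \<tau> i j * sgn_tau n \<tau> i j = 1"
  by (cases \<tau>) (auto simp: sgn_tau_def simp flip: power_add)

text \<open>Both sides are combinations of the same two matrix units, because
  \<open>k n - j = (k-1) n + j* - 1\<close> and \<open>l n + i - 1 = (l+1) n - i*\<close>, and exchanging the matrix units
  exchanges the coefficients up to a sign.\<close>

lemma XX_star:
  assumes ij: "i \<in> {1..n}" "j \<in> {1..n}" and par: "\<tau> = Dagger \<Longrightarrow> even n"
    and ell: "\<And>i. i \<in> {1..n} \<Longrightarrow> ell i = ell (star n i)"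
  shows "XX n \<epsilon> ell \<tau> i j l k
    = pscale (- ((- 1) ^ \<epsilon> * sgn_tau n \<tau> i j)) (XX n \<epsilon> ell \<tau> (star n j) (star n i) (k - 1) (l + 1))"
proof -
  have cc: "cc ell (star n i) = cc ell i" if "i \<in> {1..n}" for i
    using ell[OF that] by (simp add: cc_def fun_eq_iff)
  have "(k - 1) * int n + int (star n j) - 1 = k * int n - int j"
    "(l + 1) * int n - int (star n i) = l * int n + int i - 1"
    using ij by (auto simp: star_def of_nat_diff algebra_simps)
  note idx = this
  have sq: "((- 1) ^ \<epsilon> * (- 1) ^ \<epsilon> :: complex) = 1"
    by (simp flip: power_add)
  have sgn: "sgn_tau n \<tau> (star n j) (star n i) = sgn_tau n \<tau> i j"
    using ij par by (rule sgn_tau_star)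
  show ?thesis
    unfolding XX_def idx sgn cc[OF ij(1)] cc[OF ij(2)]
    using sq sgn_tau_square[of n \<tau> i j]
    by (intro poly_mapping_eqI)
      (simp add: lookup_pscale lookup_minus right_diff_distrib flip: mult.assoc,
       simp add: mult.assoc mult.left_commute algebra_simps)
qed

lemma XX_in_L_alg:
  assumes "i \<in> {1..n}" "j \<in> {1..n}"
  shows "XX n \<epsilon> ell \<tau> i j l k \<in> L_alg n \<epsilon> ell \<tau>"
proof -
  interpret P: vector_space "pscale :: complex \<Rightarrow> (ebasis \<Rightarrow>\<^sub>0 complex) \<Rightarrow> _"
    by (rule vector_space_pscale)
  show ?thesis unfolding L_alg_def using assms by (intro P.span_base) blast
qed

lemma Kap0_in_L_alg: "bvec Kap0 \<in> L_alg n \<epsilon> ell \<tau>"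
proof -
  interpret P: vector_space "pscale :: complex \<Rightarrow> (ebasis \<Rightarrow>\<^sub>0 complex) \<Rightarrow> _"
    by (rule vector_space_pscale)
  show ?thesis unfolding L_alg_def by (intro P.span_base) blast
qed

lemma XX_in_L_trunc:
  assumes "i \<in> {1..n}" "j \<in> {1..n}" "int s \<le> l" "k \<le> - int s"
  shows "XX n \<epsilon> ell \<tau> i j l k \<in> L_trunc n \<epsilon> ell \<tau> s"
proof -
  interpret P: vector_space "pscale :: complex \<Rightarrow> (ebasis \<Rightarrow>\<^sub>0 complex) \<Rightarrow> _"
    by (rule vector_space_pscale)
  have qr: "quo n (a * int n + int b) = a" "rem n (a * int n + int b) = b"
    and ge: "int s \<le> a * int n + int b"
    if "b \<in> {1..n}" "int s \<le> a" for a b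
  proof -
    have eq: "a * int n + int b - 1 = (int b - 1) + a * int n" by simp
    have n: "int n \<noteq> 0" "0 \<le> int b - 1" "int b - 1 < int n" using that(1) by auto
    show "quo n (a * int n + int b) = a"
      unfolding quo_def eq using n by simp
    show "rem n (a * int n + int b) = b"
      unfolding rem_def eq using n that(1) by simp
    have "a * 1 \<le> a * int n" using that by (intro mult_left_mono) auto
    then show "int s \<le> a * int n + int b" using that by simp
  qed
  have "XX n \<epsilon> ell \<tau> i j l k = XX n \<epsilon> ell \<tau> (rem n (l * int n + int i)) (rem n (- k * int n + int j))
      (quo n (l * int n + int i)) (- quo n (- k * int n + int j))"
    using qr[OF assms(1,3)] qr[OF assms(2), of "- k"] assms(4) by simp
  moreover have "int s \<le> l * int n + int i" "int s \<le> - k * int n + int j"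
    using ge[OF assms(1,3)] ge[OF assms(2), of "- k"] assms(4) by simp_all
  ultimately show ?thesis
    unfolding L_trunc_def by (intro P.span_base) blast
qed

lemma keys_XX:
  "Poly_Mapping.keys (XX n \<epsilon> ell \<tau> i j l k)
    \<subseteq> {EE (l * int n + int i - 1) (k * int n - int j), EE (k * int n - int j) (l * int n + int i - 1)}"
  by (auto simp: in_keys_iff XX_def lookup_minus lookup_pscale lookup_single when_def split: if_splits)

lemma ebracket_XX_Kap0: "ebracket n ell \<iota> (XX n \<epsilon> ell \<tau> i j l k) (bvec Kap0) = 0"
  unfolding ebracket_def by (rule bilinear_ext_eq_0) auto

lemma ebracket_XX_XX_eq_0:
  assumes "l * int n + int i - 1 \<notin> {- (l' * int n + int i'), int j' - k' * int n - 1}"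
    and "k * int n - int j \<notin> {- (l' * int n + int i'), int j' - k' * int n - 1}"
  shows "ebracket n ell \<iota> (XX n \<epsilon> ell \<tau> i j l k) (XX n \<epsilon> ell \<tau> i' j' l' k') = 0"
  unfolding ebracket_def
proof (rule bilinear_ext_eq_0)
  fix p q
  assume "p \<in> Poly_Mapping.keys (XX n \<epsilon> ell \<tau> i j l k)"
    and "q \<in> Poly_Mapping.keys (XX n \<epsilon> ell \<tau> i' j' l' k')"
  then have "p \<in> {EE (l * int n + int i - 1) (k * int n - int j), EE (k * int n - int j) (l * int n + int i - 1)}"
    and "q \<in> {EE (l' * int n + int i' - 1) (k' * int n - int j'), EE (k' * int n - int j') (l' * int n + int i' - 1)}"
    using keys_XX by blast+
  then show "ebracket_basis n ell \<iota> p q = 0"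
    using assms by (auto simp: beta_def)
qed

section \<open>Finiteness of the sums defining the action\<close>

text \<open>These are the vectors at which every sum in the definition of \<open>\<sigma>\<close> has finitely many nonzero terms,
  whichever \<open>r\<close> is: the exponent of \<open>z\<close> and \<open>r\<close> enter the range of summation only through \<open>d\<close>.\<close>

definition finite_vectors ::
    "nat \<Rightarrow> nat \<Rightarrow> (nat \<Rightarrow> nat) \<Rightarrow> tau \<Rightarrow> ((ebasis \<Rightarrow>\<^sub>0 complex) \<Rightarrow> 'v :: ab_group_add \<Rightarrow> 'v) \<Rightarrow> 'v set" where
  "finite_vectors n \<epsilon> ell \<tau> \<rho> = {v. \<forall>i\<in>{1..n}. \<forall>j\<in>{1..n}. \<forall>d.
     finite {(l, k) \<in> exponent_line ell i j d. \<rho> (XX n \<epsilon> ell \<tau> i j l k) v \<noteq> 0}}"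

text \<open>A nonzero bracket requires one of the two matrix indices of \<open>X\<^sub>i\<^sub>,\<^sub>j(l,k)\<close> to be opposite to one of
  the indices of the fixed generator, which leaves at most two values for \<open>l\<close> or at most two for \<open>k\<close>; each of \<open>l\<close> and
  \<open>k\<close> determines the other when the total exponent is given.\<close>

lemma finite_ebracket_ne_0:
  assumes n: "n \<ge> 1"
  shows "finite {(l, k) \<in> exponent_line ell i j d.
    ebracket n ell \<iota> (XX n \<epsilon> ell \<tau> i j l k) (XX n \<epsilon> ell \<tau> i' j' l' k') \<noteq> 0}"
proof -
  define F where "F = {- (l' * int n + int i'), int j' - k' * int n - 1}"
  have inj: "inj (\<lambda>l. l * int n + int i - 1)" "inj (\<lambda>k. k * int n - int j)"
    using n by (auto intro!: injI)
  have "finite ((\<lambda>l. l * int n + int i - 1) -` F)" "finite ((\<lambda>k. k * int n - int j) -` F)"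
    by (auto intro!: finite_vimageI inj simp: F_def)
  note fin = finite_exponent_line[OF this]
  have "l * int n + int i - 1 \<in> F \<or> k * int n - int j \<in> F"
    if "ebracket n ell \<iota> (XX n \<epsilon> ell \<tau> i j l k) (XX n \<epsilon> ell \<tau> i' j' l' k') \<noteq> 0" for l k
    using that ebracket_XX_XX_eq_0 unfolding F_def by metis
  then show ?thesis
    by (intro finite_subset[OF _ fin]) auto
qed

text \<open>If the \<open>X\<^sub>i\<^sub>,\<^sub>j(l,k)\<close> with fixed total exponent commute with \<open>y\<close> up to finitely many exceptions,
  then at most finitely many new nonzero terms appear in passing from \<open>v\<close> to \<open>\<rho> y v\<close>.\<close>

lemma submodule_finite_vectors:
  assumes n: "n \<ge> 1" and rep: "lie_rep (ebracket n ell \<iota>) (L_alg n \<epsilon> ell \<tau>) scale \<rho>"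
  shows "submodule (L_alg n \<epsilon> ell \<tau>) scale \<rho> (finite_vectors n \<epsilon> ell \<tau> \<rho>)"
proof -
  interpret V: vector_space scale by (rule lie_rep_vector_space[OF rep])
  let ?X = "XX n \<epsilon> ell \<tau>"
  let ?N = "\<lambda>i j d v. {(l, k) \<in> exponent_line ell i j d. \<rho> (?X i j l k) v \<noteq> 0}"
  have sub: "V.subspace (finite_vectors n \<epsilon> ell \<tau> \<rho>)"
  proof (rule V.subspaceI)
    show "0 \<in> finite_vectors n \<epsilon> ell \<tau> \<rho>"
      by (simp add: finite_vectors_def lie_rep_0_right[OF rep XX_in_L_alg])
  next
    fix u v assume uv: "u \<in> finite_vectors n \<epsilon> ell \<tau> \<rho>" "v \<in> finite_vectors n \<epsilon> ell \<tau> \<rho>"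
    have "finite (?N i j d (u + v))" if ij: "i \<in> {1..n}" "j \<in> {1..n}" for i j d
    proof (rule finite_subset)
      show "?N i j d (u + v) \<subseteq> ?N i j d u \<union> ?N i j d v"
        by (auto simp: lie_rep_add_right[OF rep XX_in_L_alg[OF ij]])
      show "finite (?N i j d u \<union> ?N i j d v)"
        using uv ij by (simp add: finite_vectors_def)
    qed
    then show "u + v \<in> finite_vectors n \<epsilon> ell \<tau> \<rho>" by (simp add: finite_vectors_def)
  next
    fix c v assume v: "v \<in> finite_vectors n \<epsilon> ell \<tau> \<rho>"
    have "finite (?N i j d (scale c v))" if ij: "i \<in> {1..n}" "j \<in> {1..n}" for i j d
    proof (rule finite_subset)
      show "?N i j d (scale c v) \<subseteq> ?N i j d v"
        by (auto simp: lie_rep_scale_right[OF rep XX_in_L_alg[OF ij]])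
      show "finite (?N i j d v)"
        using v ij by (simp add: finite_vectors_def)
    qed
    then show "scale c v \<in> finite_vectors n \<epsilon> ell \<tau> \<rho>" by (simp add: finite_vectors_def)
  qed
  have move: "\<rho> y v \<in> finite_vectors n \<epsilon> ell \<tau> \<rho>"
    if y: "y \<in> L_alg n \<epsilon> ell \<tau>" and v: "v \<in> finite_vectors n \<epsilon> ell \<tau> \<rho>"
      and fin: "\<And>i j d. finite {(l, k) \<in> exponent_line ell i j d. ebracket n ell \<iota> (?X i j l k) y \<noteq> 0}"
    for y v
  proof -
    have "finite (?N i j d (\<rho> y v))" if ij: "i \<in> {1..n}" "j \<in> {1..n}" for i j d
    proof (rule finite_subset)
      have "\<rho> (?X i j l k) (\<rho> y v) = 0"
        if "ebracket n ell \<iota> (?X i j l k) y = 0" "\<rho> (?X i j l k) v = 0" for l k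
        using lie_rep_commuting[OF rep XX_in_L_alg[OF ij] y that(1)] that(2) lie_rep_0_right[OF rep y]
        by simp
      then show "?N i j d (\<rho> y v) \<subseteq> ?N i j d v \<union>
          {(l, k) \<in> exponent_line ell i j d. ebracket n ell \<iota> (?X i j l k) y \<noteq> 0}"
        by blast
      show "finite (?N i j d v \<union>
          {(l, k) \<in> exponent_line ell i j d. ebracket n ell \<iota> (?X i j l k) y \<noteq> 0})"
        using v ij fin by (simp add: finite_vectors_def)
    qed
    then show ?thesis by (simp add: finite_vectors_def)
  qed
  show ?thesis
    unfolding L_alg_def
  proof (rule submodule_spanI[OF rep[unfolded L_alg_def] sub])
    fix x u
    assume x: "x \<in> {bvec Kap0} \<union> {XX n \<epsilon> ell \<tau> i j l k | i j l k. i \<in> {1..n} \<and> j \<in> {1..n}}"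
      and u: "u \<in> finite_vectors n \<epsilon> ell \<tau> \<rho>"
    have "x \<in> L_alg n \<epsilon> ell \<tau>"
      using x Kap0_in_L_alg XX_in_L_alg by blast
    moreover have "finite {(l, k) \<in> exponent_line ell i j d. ebracket n ell \<iota> (?X i j l k) x \<noteq> 0}" for i j d
      using x finite_ebracket_ne_0[OF n] by (auto simp: ebracket_XX_Kap0)
    ultimately show "\<rho> x u \<in> finite_vectors n \<epsilon> ell \<tau> \<rho>"
      using u by (intro move)
  qed
qed

lemma truncated_vector_in_finite_vectors:
  assumes rep: "lie_rep (ebracket n ell \<iota>) (L_alg n \<epsilon> ell \<tau>) scale \<rho>"
    and par: "\<tau> = Dagger \<Longrightarrow> even n"
    and ell: "\<And>i. i \<in> {1..n} \<Longrightarrow> ell i = ell (star n i)"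
    and ann: "\<And>x. x \<in> L_trunc n \<epsilon> ell \<tau> s \<Longrightarrow> \<rho> x v = 0"
  shows "v \<in> finite_vectors n \<epsilon> ell \<tau> \<rho>"
proof -
  interpret V: vector_space scale by (rule lie_rep_vector_space[OF rep])
  have "finite {(l, k) \<in> exponent_line ell i j d. \<rho> (XX n \<epsilon> ell \<tau> i j l k) v \<noteq> 0}"
    if ij: "i \<in> {1..n}" "j \<in> {1..n}" for i j d
  proof (rule finite_subset)
    \<comment> \<open>On the line, \<open>l + k + d\<close> lies between \<open>- \<ell>\<^sub>i - \<ell>\<^sub>j\<close> and \<open>0\<close>, so that \<open>\<bar>l\<bar> > B\<close> forces \<open>l\<close> and
      \<open>k\<close> to have opposite signs and absolute values larger than \<open>s\<close>.\<close>
    define B where "B = int s + 1 + \<bar>d\<bar> + int (ell i) + int (ell j)"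
    have "\<rho> (XX n \<epsilon> ell \<tau> i j l k) v = 0"
      if "(l, k) \<in> exponent_line ell i j d" "l \<notin> {- B..B}" for l k
    proof -
      have lk: "- int (ell i) - int (ell j) \<le> l + k + d" "l + k + d \<le> 0"
        using that(1) by (auto simp: exponent_line_def e_exp_def f_exp_def split: if_splits)
      have "l > B \<or> l < - B" using that(2) by auto
      then consider "l > B" | "l < - B" by blast
      then show ?thesis
      proof cases
        case 1
        then have "int s \<le> l" "k \<le> - int s" using lk by (auto simp: B_def)
        then show ?thesis by (intro ann XX_in_L_trunc ij)
      next
        case 2
        then have "int s \<le> k - 1" "l + 1 \<le> - int s" using lk by (auto simp: B_def)
        then have "\<rho> (XX n \<epsilon> ell \<tau> (star n j) (star n i) (k - 1) (l + 1)) v = 0"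
          by (intro ann XX_in_L_trunc star_in ij)
        moreover have "XX n \<epsilon> ell \<tau> (star n j) (star n i) (k - 1) (l + 1) \<in> L_alg n \<epsilon> ell \<tau>"
          by (intro XX_in_L_alg star_in ij)
        ultimately show ?thesis
          using XX_star[of i n j \<tau> ell \<epsilon> l k, OF ij par ell] lie_rep_scale_left[OF rep] by simp
      qed
    qed
    then show "{(l, k) \<in> exponent_line ell i j d. \<rho> (XX n \<epsilon> ell \<tau> i j l k) v \<noteq> 0}
        \<subseteq> {(l, k) \<in> exponent_line ell i j d. l \<in> {- B..B} \<or> k \<in> {}}"
      by blast
    show "finite {(l, k) \<in> exponent_line ell i j d. l \<in> {- B..B} \<or> k \<in> {}}"
      by (rule finite_exponent_line) auto
  qed
  then show ?thesis by (simp add: finite_vectors_def)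
qed

section \<open>Comparison of the two actions\<close>

text \<open>The truncation of the sum to nonzero terms depends on \<open>r\<close>, as \<open>\<langle>f\<^sub>j(k)\<rangle>\<^sub>r\<close> may vanish. For
  interpolation the summation has to be taken over one finite set that is independent of \<open>r\<close>. The mode \<open>m = r - d\<close> is the one that meets the line of exponent \<open>d\<close>.\<close>

lemma sigma_op_eq_sum:
  assumes "vector_space scale"
    and v: "v \<in> finite_vectors n \<epsilon> ell \<tau> \<rho>" and ij: "i \<in> {1..n}" "j \<in> {1..n}"
  obtains c where "sigma_op n \<epsilon> ell \<tau> \<iota> scale \<rho> i j r (int r - d) v =
    (\<Sum>p | p \<in> exponent_line ell i j d \<and> \<rho> (XX n \<epsilon> ell \<tau> i j (fst p) (snd p)) v \<noteq> 0.
      scale (falling (of_int (f_exp ell j (snd p))) r) (\<rho> (XX n \<epsilon> ell \<tau> i j (fst p) (snd p)) v))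
    + scale c (\<rho> (bvec Kap0) v)"
proof -
  interpret V: vector_space scale by fact
  let ?w = "\<lambda>p. scale (falling (of_int (f_exp ell j (snd p))) r) (\<rho> (XX n \<epsilon> ell \<tau> i j (fst p) (snd p)) v)"
  let ?S = "{p. p \<in> exponent_line ell i j d \<and> \<rho> (XX n \<epsilon> ell \<tau> i j (fst p) (snd p)) v \<noteq> 0}"
  have "finite {(l, k) \<in> exponent_line ell i j d. \<rho> (XX n \<epsilon> ell \<tau> i j l k) v \<noteq> 0}"
    using v ij by (simp add: finite_vectors_def)
  then have fin: "finite ?S" by (simp add: case_prod_unfold)
  have "(\<Sum>p | e_exp ell i (fst p) + f_exp ell j (snd p) - int r - 1 = - (int r - d) - 1 \<and> ?w p \<noteq> 0. ?w p)
      = (\<Sum>p\<in>?S. ?w p)"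
    by (rule sum.mono_neutral_left[OF fin]) (auto simp: exponent_line_def)
  then have "\<exists>c. sigma_op n \<epsilon> ell \<tau> \<iota> scale \<rho> i j r (int r - d) v = (\<Sum>p\<in>?S. ?w p) + scale c (\<rho> (bvec Kap0) v)"
    unfolding sigma_op_def Let_def case_prod_unfold
    by (auto intro: exI[of _ "0 :: complex"])
  then show ?thesis using that by blast
qed

lemma submodule_sigma_imp_rho:
  assumes rep: "lie_rep (ebracket n ell \<iota>) (L_alg n \<epsilon> ell \<tau>) scale \<rho>"
    and fin: "finite_vectors n \<epsilon> ell \<tau> \<rho> = UNIV"
    and sig: "is_sigma n \<epsilon> ell \<tau> \<iota> scale \<rho> \<sigma>"
    and U: "submodule (osp_alg n \<epsilon> ell \<tau>) scale \<sigma> U"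
  shows "submodule (L_alg n \<epsilon> ell \<tau>) scale \<rho> U"
proof -
  note vs = lie_rep_vector_space[OF rep]
  interpret V: vector_space scale by (rule vs)
  interpret P: vector_space "pscale :: complex \<Rightarrow> (dbasis \<Rightarrow>\<^sub>0 complex) \<Rightarrow> _"
    by (rule vector_space_pscale)
  have sub: "V.subspace U" using U by (simp add: submodule_def)
  have "bvec Kap \<in> osp_alg n \<epsilon> ell \<tau>"
    unfolding osp_alg_def by (intro P.span_base) blast
  then have "\<sigma> (bvec Kap) v \<in> U" if "v \<in> U" for v
    using U that by (simp add: submodule_def)
  then have kap: "\<rho> (bvec Kap0) v \<in> U" if "v \<in> U" for v
    using sig that by (simp add: is_sigma_def)
  have X: "\<rho> (XX n \<epsilon> ell \<tau> i j l k) v \<in> U"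
    if ij: "i \<in> {1..n}" "j \<in> {1..n}" and v: "v \<in> U" for i j l k v
  proof (cases "\<rho> (XX n \<epsilon> ell \<tau> i j l k) v = 0")
    case True
    then show ?thesis using V.subspace_0[OF sub] by simp
  next
    case False
    define d where "d = e_exp ell i l + f_exp ell j k"
    define S where "S = {p. p \<in> exponent_line ell i j d \<and> \<rho> (XX n \<epsilon> ell \<tau> i j (fst p) (snd p)) v \<noteq> 0}"
    define w where "w p = \<rho> (XX n \<epsilon> ell \<tau> i j (fst p) (snd p)) v" for p
    define g where "g p = (of_int (f_exp ell j (snd p)) :: complex)" for p :: "int \<times> int"
    have vf: "v \<in> finite_vectors n \<epsilon> ell \<tau> \<rho>" using fin by simp
    then have "finite {(l, k) \<in> exponent_line ell i j d. \<rho> (XX n \<epsilon> ell \<tau> i j l k) v \<noteq> 0}"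
      using ij by (simp add: finite_vectors_def)
    then have "finite S" by (simp add: S_def case_prod_unfold)
    moreover have "inj_on g S"
    proof (rule inj_onI)
      fix p q assume pq: "p \<in> S" "q \<in> S" "g p = g q"
      then have "snd p = snd q" by (auto simp: g_def dest: f_exp_inj)
      then show "p = q"
        using pq inj_onD[OF inj_on_snd_exponent_line, of p q] by (auto simp: S_def)
    qed
    moreover have "(l, k) \<in> S" using False by (simp add: S_def d_def exponent_line_def)
    moreover have "(\<Sum>p\<in>S. scale (falling (g p) r) (w p)) \<in> U" for r
    proof -
      obtain c where c: "sigma_op n \<epsilon> ell \<tau> \<iota> scale \<rho> i j r (int r - d) v =
          (\<Sum>p\<in>S. scale (falling (g p) r) (w p)) + scale c (\<rho> (bvec Kap0) v)"
        unfolding S_def g_def w_def by (rule sigma_op_eq_sum[OF vs vf ij])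
      have "dgen n \<epsilon> ell \<tau> i j r (int r - d) \<in> osp_alg n \<epsilon> ell \<tau>"
        unfolding osp_alg_def using ij by (intro P.span_base) blast
      then have "\<sigma> (dgen n \<epsilon> ell \<tau> i j r (int r - d)) v \<in> U"
        using U v by (simp add: submodule_def)
      then have "sigma_op n \<epsilon> ell \<tau> \<iota> scale \<rho> i j r (int r - d) v \<in> U"
        using sig ij by (simp add: is_sigma_def)
      from V.subspace_diff[OF sub this V.subspace_scale[OF sub kap[OF v], of c]]
      show ?thesis by (simp add: c)
    qed
    ultimately have "w (l, k) \<in> U"
      by (rule summand_in_subspace[OF vs sub])
    then show ?thesis by (simp add: w_def)
  qed
  show ?thesis
    unfolding L_alg_def
    by (rule submodule_spanI[OF rep[unfolded L_alg_def] sub]) (auto simp: kap X)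
qed

lemma submodule_rho_imp_sigma:
  assumes vs: "vector_space scale"
    and sig: "is_sigma n \<epsilon> ell \<tau> \<iota> scale \<rho> \<sigma>"
    and U: "submodule (L_alg n \<epsilon> ell \<tau>) scale \<rho> U"
  shows "submodule (osp_alg n \<epsilon> ell \<tau>) scale \<sigma> U"
proof -
  interpret V: vector_space scale by (rule vs)
  have sub: "V.subspace U" using U by (simp add: submodule_def)
  have kap: "\<rho> (bvec Kap0) v \<in> U" if "v \<in> U" for v
    using U that Kap0_in_L_alg by (auto simp: submodule_def)
  have X: "\<rho> (XX n \<epsilon> ell \<tau> i j l k) v \<in> U"
    if "i \<in> {1..n}" "j \<in> {1..n}" "v \<in> U" for i j l k v
    using U that XX_in_L_alg by (auto simp: submodule_def)
  have "sigma_op n \<epsilon> ell \<tau> \<iota> scale \<rho> i j r m v \<in> U"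
    if ij: "i \<in> {1..n}" "j \<in> {1..n}" and v: "v \<in> U" for i j r m v
    unfolding sigma_op_def Let_def case_prod_unfold
    using X[OF ij v] kap[OF v] V.subspace_0[OF sub]
    by (intro V.subspace_add[OF sub] V.subspace_sum[OF sub]) (auto intro: V.subspace_scale[OF sub])
  then have gen: "\<sigma> x v \<in> U"
    if "x \<in> {bvec Kap} \<union> {dgen n \<epsilon> ell \<tau> i j r m | i j r m. i \<in> {1..n} \<and> j \<in> {1..n}}" "v \<in> U" for x v
    using that sig kap by (auto simp: is_sigma_def)
  have "lie_rep dbracket (osp_alg n \<epsilon> ell \<tau>) scale \<sigma>"
    using sig by (simp add: is_sigma_def)
  from submodule_spanI[OF this[unfolded osp_alg_def] sub gen] show ?thesis
    unfolding osp_alg_def .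
qed

theorem theorem5p2:
  fixes n \<epsilon> :: nat and ell :: "nat \<Rightarrow> nat" and \<tau> :: tau and \<iota> :: int
    and scale :: "complex \<Rightarrow> 'v :: ab_group_add \<Rightarrow> 'v"
    and \<rho> :: "(ebasis \<Rightarrow>\<^sub>0 complex) \<Rightarrow> 'v \<Rightarrow> 'v"
    and \<sigma> :: "(dbasis \<Rightarrow>\<^sub>0 complex) \<Rightarrow> 'v \<Rightarrow> 'v"
    and M0 :: "'v set"
  assumes "n \<ge> 1"
    and "\<epsilon> \<in> {0, 1}"
    and "\<And>i. i \<in> {1..n} \<Longrightarrow> \<exists>k. ell i = 2 * k + \<epsilon>"
    and "\<And>i. i \<in> {1..n} \<Longrightarrow> ell i = ell (star n i)"
    and "\<tau> = Dagger \<Longrightarrow> even n"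
    and "lie_rep (ebracket n ell \<iota>) (L_alg n \<epsilon> ell \<tau>) scale \<rho>"
    and "weighted torus scale \<rho>"
    and "module.subspace scale M0"
    and "generated_by (L_alg n \<epsilon> ell \<tau>) scale \<rho> M0"
    and "\<exists>s::nat. int s > ell_bar n ell \<iota> \<and> (\<forall>x\<in>L_trunc n \<epsilon> ell \<tau> s. \<forall>v\<in>M0. \<rho> x v = 0)"
    and "is_sigma n \<epsilon> ell \<tau> \<iota> scale \<rho> \<sigma>"
  shows "irreducible_rep (osp_alg n \<epsilon> ell \<tau>) scale \<sigma> \<longleftrightarrow> irreducible_rep (L_alg n \<epsilon> ell \<tau>) scale \<rho>"
proof -
  obtain s where s: "\<And>x v. x \<in> L_trunc n \<epsilon> ell \<tau> s \<Longrightarrow> v \<in> M0 \<Longrightarrow> \<rho> x v = 0"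
    using assms(10) by blast
  have "v \<in> finite_vectors n \<epsilon> ell \<tau> \<rho>" if "v \<in> M0" for v
    using assms(6,5,4) s[OF _ that] by (rule truncated_vector_in_finite_vectors)
  then have "M0 \<subseteq> finite_vectors n \<epsilon> ell \<tau> \<rho>" by blast
  then have fin: "finite_vectors n \<epsilon> ell \<tau> \<rho> = UNIV"
    using assms(9) submodule_finite_vectors[OF assms(1,6)] by (simp add: generated_by_def)
  have "submodule (osp_alg n \<epsilon> ell \<tau>) scale \<sigma> U \<longleftrightarrow> submodule (L_alg n \<epsilon> ell \<tau>) scale \<rho> U" for U
    by (rule iffI[OF submodule_sigma_imp_rho[OF assms(6) fin assms(11)]
      submodule_rho_imp_sigma[OF lie_rep_vector_space[OF assms(6)] assms(11)]])
  then show ?thesis by (simp add: irreducible_rep_def)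
qed

end
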